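(* Let $\widehat{O}_t$ be a linear differential operator acting on the variable $t$. Let $f_1(t)$ be a solution of the nonlinear equation $$\widehat{O}_t f_1(t)=f_1^2(t),$$ and let $f_2(t)$, $f_3(t)$ satisfy the equations $$\widehat{O}_t f_2=f_1f_2,\qquad \widehat{O}_t f_3=f_1f_3 .$$ Then the function $$u(\eta,t)=f_1(t)\ln(\sinh\eta)+f_2(t)\ln\left(\tanh\tfrac{\eta}{2}\right)+f_3(t),\qquad \eta>0,$$ is a solution of the nonlinear diffusion equation $$\widehat{O}_t u(\eta,t)=\frac{u}{\sinh\eta}\frac{\partial}{\partial\eta}\left(\sinh\eta\,\frac{\partial u}{\partial\eta}\right).$$
   Context: Here $\eta>0$ is the hyperbolic distance coordinate, and the operator $\Delta_H=\frac{1}{\sinh\eta}\frac{\partial}{\partial\eta}\sinh\eta\frac{\partial}{\partial\eta}$ is the radial part of the Laplacian on the hyperbolic (Poincaré half) plane, so the equation reads $\widehat{O}_t u=u\,\Delta_H u$. The operator $\widehat{O}_t$ is a linear (possibly fractional) differential operator in time; examples are $\frac{\partial}{\partial t}$, the Laguerre derivative $\frac{\partial}{\partial t}t\frac{\partial}{\partial t}$, and the Caputo derivative of order $\beta\in(0,1)$. Formally: $T\subseteq\mathbb{R}$ is a time interval, $V$ is a linear space of functions on $T$, and $\widehat{O}_t$ is a linear map from $V$ to functions on $T$. It acts on functions of $(\eta,t)$ by fixing $\eta$, i.e. $(\widehat{O}_t u)(\eta,t)=(\widehat{O}_t[u(\eta,\cdot)])(t)$. The functions $f_1,f_2,f_3$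 are elements of $V$. *)

theory Defs
  imports "HOL-Analysis.Analysis" "HOL-Library.FuncSet"
begin

text \<open>
  Real-valued functions on a set T of times are represented by the elements of
  \<^term>\<open>extensional T\<close>, so that two of them are equal iff they agree on T.
\<close>

definition linear_space_on :: "real set \<Rightarrow> (real \<Rightarrow> real) set \<Rightarrow> bool" where
  "linear_space_on T V \<longleftrightarrow>
     V \<subseteq> extensional T \<and>
     (\<lambda>t\<in>T. 0) \<in> V \<and>
     (\<forall>f\<in>V. \<forall>g\<in>V. (\<lambda>t\<in>T. f t + g t) \<in> V) \<and>
     (\<forall>c. \<forall>f\<in>V. (\<lambda>t\<in>T. c * f t) \<in> V)"

definition linear_operator_on ::
    "real set \<Rightarrow> (real \<Rightarrow> real) set \<Rightarrow> ((real \<Rightarrow> real) \<Rightarrow> (real \<Rightarrow> real)) \<Rightarrow> bool" where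
  "linear_operator_on T V D \<longleftrightarrow>
     D \<in> V \<rightarrow> extensional T \<and>
     (\<forall>f\<in>V. \<forall>g\<in>V. D (\<lambda>t\<in>T. f t + g t) = (\<lambda>t\<in>T. D f t + D g t)) \<and>
     (\<forall>c. \<forall>f\<in>V. D (\<lambda>t\<in>T. c * f t) = (\<lambda>t\<in>T. c * D f t))"

text \<open>
  A solution must lie in the domain of both sides: every time slice belongs to V, and the
  two spatial derivatives exist. The latter has to be required explicitly, since
  \<^const>\<open>deriv\<close> is total.
\<close>

definition solves_hyperbolic_diffusion ::
    "real set \<Rightarrow> (real \<Rightarrow> real) set \<Rightarrow> ((real \<Rightarrow> real) \<Rightarrow> (real \<Rightarrow> real)) \<Rightarrow>
     (real \<Rightarrow> real \<Rightarrow> real) \<Rightarrow> bool" where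
  "solves_hyperbolic_diffusion T V D u \<longleftrightarrow>
     (\<forall>\<eta>>0. (\<lambda>t\<in>T. u \<eta> t) \<in> V) \<and>
     (\<forall>\<eta>>0. \<forall>t\<in>T.
        (\<lambda>x. u x t) field_differentiable (at \<eta>) \<and>
        (\<lambda>x. sinh x * deriv (\<lambda>y. u y t) x) field_differentiable (at \<eta>) \<and>
        D (\<lambda>s\<in>T. u \<eta> s) t =
          u \<eta> t / sinh \<eta> * deriv (\<lambda>x. sinh x * deriv (\<lambda>y. u y t) x) \<eta>)"

end

theory Submission
  imports Defs
begin

text \<open>
  Write \<open>A g = (1 / sinh \<eta>) (sinh \<eta> g')'\<close> for the radial Laplacian. In the span of
  \<open>ln (sinh \<eta>)\<close>, \<open>ln (tanh (\<eta> / 2))\<close> and \<open>1\<close> it acts very simply: multiplied by \<open>sinh \<eta>\<close>, the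
  derivatives of these functions are \<open>cosh \<eta>\<close>, \<open>1\<close> and \<open>0\<close>, so \<open>A\<close> sends them to \<open>1\<close>, \<open>0\<close> and
  \<open>0\<close>. Hence for the proposed \<open>u\<close> the spatial side \<open>u A u\<close> is just \<open>f1 u\<close>. On the other side,
  with \<open>\<eta>\<close> fixed, \<open>u\<close> is a linear combination of \<open>f1\<close>, \<open>f2\<close> and \<open>f3\<close>, and each of them is
  multiplied by \<open>f1\<close> under the time operator; by linearity, so is \<open>u\<close>. This gives \<open>f1 u\<close> again.

  The temporal half rests on \<open>linear_operator_on_add_scaled\<close>, the spatial half on
  \<open>sinh_times_deriv_log_profile\<close> and \<open>has_derivative_sinh_times_deriv_log_profile\<close>.
\<close>

lemma linear_space_on_add_scaled:
  assumes "linear_space_on T V" and "f \<in> V" and "g \<in> V"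
  shows "(\<lambda>t\<in>T. f t * c + g t) \<in> V"
proof -
  have "(\<lambda>t\<in>T. c * f t) \<in> V"
    using assms by (simp add: linear_space_on_def)
  then have "(\<lambda>t\<in>T. (\<lambda>t\<in>T. c * f t) t + g t) \<in> V"
    using assms(1,3) unfolding linear_space_on_def by blast
  also have "(\<lambda>t\<in>T. (\<lambda>t\<in>T. c * f t) t + g t) = (\<lambda>t\<in>T. f t * c + g t)"
    by (auto simp: restrict_def)
  finally show ?thesis .
qed

lemma linear_operator_on_add_scaled:
  assumes "linear_space_on T V" and "linear_operator_on T V D"
    and "f \<in> V" and "g \<in> V" and "t \<in> T"
  shows "D (\<lambda>t\<in>T. f t * c + g t) t = D f t * c + D g t"
proof -
  have V: "(\<lambda>t\<in>T. c * f t) \<in> V"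
    using assms by (simp add: linear_space_on_def)
  have "D (\<lambda>t\<in>T. f t * c + g t) = D (\<lambda>t\<in>T. (\<lambda>t\<in>T. c * f t) t + g t)"
    by (rule arg_cong[of _ _ D]) (auto simp: restrict_def)
  also have "\<dots> = (\<lambda>t\<in>T. D (\<lambda>t\<in>T. c * f t) t + D g t)"
    using assms(2,4) V unfolding linear_operator_on_def by blast
  also have "D (\<lambda>t\<in>T. c * f t) = (\<lambda>t\<in>T. c * D f t)"
    using assms(2,3) unfolding linear_operator_on_def by blast
  finally have "D (\<lambda>t\<in>T. f t * c + g t) t = (\<lambda>t\<in>T. (\<lambda>t\<in>T. c * D f t) t + D g t) t"
    by (rule fun_cong)
  also have "\<dots> = D f t * c + D g t"
    using assms(5) by simp
  finally show ?thesis .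
qed

text \<open>
  The half-angle factors combine: the chain rule gives \<open>1 / (2 sinh (x / 2) cosh (x / 2))\<close>, and
  the denominator is \<open>sinh x\<close>.
\<close>
lemma has_field_derivative_ln_tanh_half:
  fixes x :: real
  assumes "x > 0"
  shows "((\<lambda>x. ln (tanh (x / 2))) has_field_derivative 1 / sinh x) (at x)"
proof -
  have pos: "sinh (x / 2) > 0" "cosh (x / 2) > 0" "tanh (x / 2) > 0"
    using assms by (auto simp: cosh_real_pos)
  have dbl: "sinh x = 2 * sinh (x / 2) * cosh (x / 2)"
    using sinh_double[of "x / 2"] by simp
  have "1 - (tanh (x / 2))\<^sup>2 = ((cosh (x / 2))\<^sup>2 - (sinh (x / 2))\<^sup>2) / (cosh (x / 2))\<^sup>2"
    using pos by (simp add: tanh_def power_divide diff_divide_distrib)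
  also have "(cosh (x / 2))\<^sup>2 - (sinh (x / 2))\<^sup>2 = 1"
    by (simp add: cosh_square_eq)
  finally have "1 / tanh (x / 2) * ((1 - (tanh (x / 2))\<^sup>2) * (1 / 2)) = 1 / sinh x"
    using pos by (simp add: dbl tanh_def power2_eq_square)
  moreover have "((\<lambda>x. ln (tanh (x / 2))) has_field_derivative
      1 / tanh (x / 2) * ((1 - (tanh (x / 2))\<^sup>2) * (1 / 2))) (at x)"
    using pos by (auto intro!: derivative_eq_intros)
  ultimately show ?thesis
    by simp
qed

lemma has_field_derivative_log_profile:
  fixes x :: real
  assumes "x > 0"
  shows "((\<lambda>x. a * ln (sinh x) + b * ln (tanh (x / 2)) + c) has_field_derivative
           (a * cosh x + b) / sinh x) (at x)"
proof -
  have "((\<lambda>x. ln (sinh x)) has_field_derivative cosh x / sinh x) (at x)"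
    using assms by (auto intro!: derivative_eq_intros)
  then have "((\<lambda>x. a * ln (sinh x) + b * ln (tanh (x / 2)) + c) has_field_derivative
      a * (cosh x / sinh x) + b * (1 / sinh x) + 0) (at x)"
    by (intro DERIV_add DERIV_cmult DERIV_const has_field_derivative_ln_tanh_half assms)
  then show ?thesis
    by (simp add: add_divide_distrib)
qed

text \<open>
  The factor \<open>sinh x\<close> in the flux cancels the singularity of the gradient; what remains is so
  simple that its derivative is proportional to \<open>sinh x\<close>.
\<close>
lemma sinh_times_deriv_log_profile:
  fixes x :: real
  assumes "x > 0"
  shows "sinh x * deriv (\<lambda>x. a * ln (sinh x) + b * ln (tanh (x / 2)) + c) x = a * cosh x + b"
  using DERIV_imp_deriv[OF has_field_derivative_log_profile[OF assms]] assms by simp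

lemma has_derivative_sinh_times_deriv_log_profile:
  fixes x :: real
  assumes "x > 0"
  shows "((\<lambda>x. sinh x * deriv (\<lambda>y. a * ln (sinh y) + b * ln (tanh (y / 2)) + c) x)
           has_field_derivative a * sinh x) (at x)"
proof -
  have "((\<lambda>x. a * cosh x + b) has_field_derivative a * sinh x) (at x)"
    by (auto intro!: derivative_eq_intros)
  then show ?thesis
    \<comment> \<open>The closed form of the flux holds only for positive arguments, which is enough because
      they form an open set.\<close>
    by (rule has_field_derivative_transform_within_open[of _ _ _ "{0<..}"])
      (use assms in \<open>auto simp: sinh_times_deriv_log_profile\<close>)
qed

theorem theorem2:
  fixes T :: "real set"
    and V :: "(real \<Rightarrow> real) set"
    and D :: "(real \<Rightarrow> real) \<Rightarrow> (real \<Rightarrow> real)"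
    and f1 f2 f3 :: "real \<Rightarrow> real"
  assumes "is_interval T"
    and "linear_space_on T V"
    and "linear_operator_on T V D"
    and "f1 \<in> V" and "f2 \<in> V" and "f3 \<in> V"
    and "\<forall>t\<in>T. D f1 t = (f1 t)\<^sup>2"
    and "\<forall>t\<in>T. D f2 t = f1 t * f2 t"
    and "\<forall>t\<in>T. D f3 t = f1 t * f3 t"
  shows "solves_hyperbolic_diffusion T V D
           (\<lambda>\<eta> t. f1 t * ln (sinh \<eta>) + f2 t * ln (tanh (\<eta> / 2)) + f3 t)"
proof -
  let ?u = "\<lambda>\<eta> t. f1 t * ln (sinh \<eta>) + f2 t * ln (tanh (\<eta> / 2)) + f3 t"
  have inner: "(\<lambda>t\<in>T. f2 t * b + f3 t) \<in> V" for b
    using assms by (intro linear_space_on_add_scaled)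
  have nested: "(\<lambda>t\<in>T. f1 t * a + f2 t * b + f3 t)
      = (\<lambda>t\<in>T. f1 t * a + (\<lambda>t\<in>T. f2 t * b + f3 t) t)" for a b
    by (auto simp: restrict_def)
  have slice: "(\<lambda>t\<in>T. f1 t * a + f2 t * b + f3 t) \<in> V" for a b
    unfolding nested using assms inner by (intro linear_space_on_add_scaled)
  have time: "D (\<lambda>t\<in>T. f1 t * a + f2 t * b + f3 t) t = f1 t * (f1 t * a + f2 t * b + f3 t)"
    if "t \<in> T" for a b t
  proof -
    have "D (\<lambda>t\<in>T. f1 t * a + f2 t * b + f3 t) t = D f1 t * a + D (\<lambda>t\<in>T. f2 t * b + f3 t) t"
      unfolding nested using assms inner that by (intro linear_operator_on_add_scaled)
    also have "D (\<lambda>t\<in>T. f2 t * b + f3 t) t = D f2 t * b + D f3 t"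
      using assms that by (intro linear_operator_on_add_scaled)
    also have "D f1 t * a + (D f2 t * b + D f3 t) = f1 t * (f1 t * a + f2 t * b + f3 t)"
      using assms(7-9) that by (simp add: algebra_simps power2_eq_square)
    finally show ?thesis .
  qed
  have space: "?u \<eta> t / sinh \<eta> * deriv (\<lambda>x. sinh x * deriv (\<lambda>y. ?u y t) x) \<eta> = f1 t * ?u \<eta> t"
    if "\<eta> > 0" for \<eta> t
    using DERIV_imp_deriv[OF has_derivative_sinh_times_deriv_log_profile[OF that]] that by simp
  show ?thesis
    unfolding solves_hyperbolic_diffusion_def
  proof (intro conjI allI impI ballI)
    fix \<eta> t :: real
    assume pos: "\<eta> > 0" and t: "t \<in> T"
    show "(\<lambda>x. ?u x t) field_differentiable (at \<eta>)"
      using has_field_derivative_log_profile[OF pos] field_differentiable_def by blast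
    show "(\<lambda>x. sinh x * deriv (\<lambda>y. ?u y t) x) field_differentiable (at \<eta>)"
      using has_derivative_sinh_times_deriv_log_profile[OF pos] field_differentiable_def by blast
    show "D (\<lambda>s\<in>T. ?u \<eta> s) t =
        ?u \<eta> t / sinh \<eta> * deriv (\<lambda>x. sinh x * deriv (\<lambda>y. ?u y t) x) \<eta>"
      by (simp only: time[OF t] space[OF pos])
  qed (rule slice)
qed

end
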